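(* Let $k \geq 0$ and let $F$ be a $k$-edge graph with $\gamma(F) = 1$, i.e. $F$ has a vertex adjacent to all other vertices of $F$. Let $m \ge 0$ and let $G$ be a connected $m$-edge graph such that $(G,F)$ is not special, i.e. $G$ is not a copy of $F$, and it is not the case that $F$ is a copy of $P_3$ (equivalently $K_{1,2}$) and $G$ is a copy of the $6$-cycle $C_6$. Then \[\iota(G,F) \leq \left\lfloor \frac{m+1}{k+2} \right\rfloor.\] Moreover, equality holds if $G$ is an $(m,F)$-special graph.
   Context: All graphs are finite and simple. For a graph $G$ and $D \subseteq V(G)$, $N[D]$ denotes the closed neighbourhood $\bigcup_{v\in D} N[v]$ of $D$ in $G$, and $G - N[D]$ is the graph obtained by deleting the vertices of $N[D]$. A graph is an $F$-copy if it is isomorphic to $F$. A set $D \subseteq V(G)$ is an $F$-isolating set of $G$ if $G - N[D]$ contains no subgraph that is an $F$-copy; $\iota(G,F)$ is the size of a smallest $F$-isolating set of $G$. $\gamma(F)$ is the domination number of $F$. $P_3$ is the path on $3$ vertices and $C_6$ the cycle on $6$ vertices. $(m,F)$-special graph (for $F$ a connected $k$-edge graph, with $F \simeq K_1$ if $k=0$): write $m+1 = q(k+2)+r$ with integers $q \ge 0$ and $0 \le r \le k+1$. If $q = 0$, an $(m,F)$-special graph is any connected $m$-edge graph. If $q \geq 1$: take distinct vertices $v_1,\dots,v_q$ and copies $F_1,\dots,F_q$ of $F$ such that $V(F_1),\dots,V(F_q)$ and $\{v_1,\dots,v_q\}$ are pairwise disjoint; for each $i\in[q]$ pick $w_i \in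 V(F_i)$ and let $G_i$ be the graph with vertex set $\{v_i\}\cup V(F_i)$ and edge set $\{v_iw_i\}\cup E(F_i)$. Let $T$ be any tree with vertex set $\{v_1,\dots,v_q\}$, and let $T'$ be any connected $r$-edge graph with $V(T') \cap \bigcup_{i=1}^q V(G_i) = \{v_q\}$. Then the graph $G$ with $V(G) = V(T') \cup \bigcup_{i=1}^q V(G_i)$ and $E(G) = E(T)\cup E(T')\cup \bigcup_{i=1}^q E(G_i)$ is an $(m,F)$-special graph. (Every such graph is a connected $m$-edge graph.) *)

theory Defs
  imports Main
begin

type_synonym 'a graph = "'a set \<times> 'a set set"

definition verts :: "'a graph \<Rightarrow> 'a set" where "verts G = fst G"
definition edges :: "'a graph \<Rightarrow> 'a set set" where "edges G = snd G"

definition graph :: "'a graph \<Rightarrow> bool" where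
  "graph G \<longleftrightarrow> finite (verts G) \<and>
     (\<forall>e\<in>edges G. \<exists>u v. e = {u, v} \<and> u \<noteq> v \<and> u \<in> verts G \<and> v \<in> verts G)"

definition adj :: "'a graph \<Rightarrow> 'a \<Rightarrow> 'a \<Rightarrow> bool" where
  "adj G u v \<longleftrightarrow> {u, v} \<in> edges G"

definition connected :: "'a graph \<Rightarrow> bool" where
  "connected G \<longleftrightarrow> verts G \<noteq> {} \<and> (\<forall>u\<in>verts G. \<forall>v\<in>verts G. (adj G)\<^sup>*\<^sup>* u v)"

definition has_cycle :: "'a graph \<Rightarrow> bool" where
  "has_cycle G \<longleftrightarrow> (\<exists>xs. distinct xs \<and> length xs \<ge> 3 \<and> set xs \<subseteq> verts G \<and>
     (\<forall>i. Suc i < length xs \<longrightarrow> adj G (xs ! i) (xs ! Suc i)) \<and> adj G (last xs) (hd xs))"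

definition tree :: "'a graph \<Rightarrow> bool" where
  "tree G \<longleftrightarrow> graph G \<and> connected G \<and> \<not> has_cycle G"

definition closed_nbhd :: "'a graph \<Rightarrow> 'a set \<Rightarrow> 'a set" where
  "closed_nbhd G D = D \<union> {u \<in> verts G. \<exists>v\<in>D. adj G u v}"

definition delete_verts :: "'a graph \<Rightarrow> 'a set \<Rightarrow> 'a graph" where
  "delete_verts G X = (verts G - X, {e \<in> edges G. e \<inter> X = {}})"

definition subgraph :: "'a graph \<Rightarrow> 'a graph \<Rightarrow> bool" where
  "subgraph H G \<longleftrightarrow> graph H \<and> verts H \<subseteq> verts G \<and> edges H \<subseteq> edges G"

definition graph_iso :: "('b \<Rightarrow> 'a) \<Rightarrow> 'b graph \<Rightarrow> 'a graph \<Rightarrow> bool" where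
  "graph_iso f F H \<longleftrightarrow> bij_betw f (verts F) (verts H) \<and>
     (\<forall>u\<in>verts F. \<forall>v\<in>verts F. {u, v} \<in> edges F \<longleftrightarrow> {f u, f v} \<in> edges H)"

definition is_copy :: "'a graph \<Rightarrow> 'b graph \<Rightarrow> bool" where
  "is_copy H F \<longleftrightarrow> (\<exists>f. graph_iso f F H)"

definition contains_copy :: "'a graph \<Rightarrow> 'b graph \<Rightarrow> bool" where
  "contains_copy G F \<longleftrightarrow> (\<exists>H. subgraph H G \<and> is_copy H F)"

definition isolating :: "'a graph \<Rightarrow> 'b graph \<Rightarrow> 'a set \<Rightarrow> bool" where
  "isolating G F D \<longleftrightarrow> D \<subseteq> verts G \<and> \<not> contains_copy (delete_verts G (closed_nbhd G D)) F"

definition iota :: "'a graph \<Rightarrow> 'b graph \<Rightarrow> nat" where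
  "iota G F = (LEAST n. \<exists>D. isolating G F D \<and> card D = n)"

definition dominating :: "'a graph \<Rightarrow> 'a set \<Rightarrow> bool" where
  "dominating G D \<longleftrightarrow> D \<subseteq> verts G \<and> closed_nbhd G D = verts G"

definition domination_number :: "'a graph \<Rightarrow> nat" where
  "domination_number G = (LEAST n. \<exists>D. dominating G D \<and> card D = n)"

definition P3 :: "nat graph" where
  "P3 = ({0, 1, 2}, {{0, 1}, {1, 2}})"

definition C6 :: "nat graph" where
  "C6 = ({0..<6}, {{i, (i + 1) mod 6} | i. i < 6})"

definition special_graph :: "nat \<Rightarrow> 'b graph \<Rightarrow> 'a graph \<Rightarrow> bool" where
  "special_graph m F G \<longleftrightarrow>
    (let k = card (edges F); q = (m + 1) div (k + 2); r = (m + 1) mod (k + 2) in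
     if q = 0 then graph G \<and> connected G \<and> card (edges G) = m
     else (\<exists>(v :: nat \<Rightarrow> 'a) (FF :: nat \<Rightarrow> 'a graph) (w :: nat \<Rightarrow> 'a) (ET :: 'a set set) (T' :: 'a graph).
        let Gi = (\<lambda>i. (insert (v i) (verts (FF i)), insert {v i, w i} (edges (FF i)))) in
        inj_on v {1..q} \<and>
        (\<forall>i\<in>{1..q}. graph (FF i) \<and> is_copy (FF i) F) \<and>
        (\<forall>i\<in>{1..q}. \<forall>j\<in>{1..q}. i \<noteq> j \<longrightarrow> verts (FF i) \<inter> verts (FF j) = {}) \<and>
        (\<forall>i\<in>{1..q}. verts (FF i) \<inter> v ` {1..q} = {}) \<and>
        (\<forall>i\<in>{1..q}. w i \<in> verts (FF i)) \<and>
        tree (v ` {1..q}, ET) \<and>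
        graph T' \<and> connected T' \<and> card (edges T') = r \<and>
        verts T' \<inter> (\<Union>i\<in>{1..q}. verts (Gi i)) = {v q} \<and>
        G = (verts T' \<union> (\<Union>i\<in>{1..q}. verts (Gi i)),
             ET \<union> edges T' \<union> (\<Union>i\<in>{1..q}. edges (Gi i)))))"

end

(*
  Upper bound: work with the vertex sets U of induced subgraphs of a fixed G and take a minimal
  connected counterexample U. Call a connected set bad if it induces a copy of F, or if k = 2 and
  it induces a C6. A bad set K misses the bound by exactly one edge, so it does no harm if at least
  two edges join it to the rest. If exactly one edge yz with z in K does, put y into the isolating
  set: then z is deleted and the rest of K costs at least one vertex less. Hence no bad part hangs
  on a single edge, and each proper part W of U costs at most (number of edges meeting W)/(k+2).
  Let v be the centre of a copy of F. Deleting N[v] spends one vertex on the edges inside N[v],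
  so these number exactly k, and every component K of the rest is tight. If K is not bad, a single
  edge yz joins it to N[v], and deleting z instead of N[v] saves enough by rounding. So all
  components are bad, and tightness around all centres forces U to consist of two copies of F
  joined by two edges; four candidates for a single isolating vertex fail only for U = C6.
  Lower bound: N[V(F_i)] = V(G_i), so an isolating set has a vertex in each of the q disjoint V(G_i).
*)
theory Submission
  imports Defs
begin

section \<open>Finite graphs, isomorphisms and the 6-cycle\<close>

lemma graph_edgeE:
  assumes "graph G" "e \<in> edges G"
  obtains u v where "e = {u, v}" "u \<noteq> v" "u \<in> verts G" "v \<in> verts G"
  using assms unfolding graph_def by blast

lemma graphI:
  assumes "finite (verts G)" "\<And>e. e \<in> edges G \<Longrightarrow> e \<subseteq> verts G \<and> card e = 2"
  shows "graph G"
  unfolding graph_def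
proof (intro conjI ballI)
  fix e assume "e \<in> edges G"
  then show "\<exists>u v. e = {u, v} \<and> u \<noteq> v \<and> u \<in> verts G \<and> v \<in> verts G"
    using assms(2)[of e] by (auto simp: card_2_iff)
qed (rule assms(1))

lemma graph_edge_subset: "graph G \<Longrightarrow> e \<in> edges G \<Longrightarrow> e \<subseteq> verts G"
  by (erule graph_edgeE) auto

lemma graph_finite_edges: "graph G \<Longrightarrow> finite (edges G)"
  by (rule finite_subset[of _ "Pow (verts G)"]) (auto dest: graph_edge_subset simp: graph_def)

text \<open>An injection on vertices is injective on edges. Equal edge counts then make it onto
  \<open>edges B\<close>, so it reflects edges as well as preserving them.\<close>

lemma graph_iso_if_card_edges_eq:
  assumes "graph A" "graph B" "inj_on f (verts A)" "f ` verts A = verts B"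
    and "\<And>e. e \<in> edges A \<Longrightarrow> f ` e \<in> edges B" and "card (edges A) = card (edges B)"
  shows "graph_iso f A B"
proof -
  have sub: "edges A \<subseteq> Pow (verts A)" using graph_edge_subset[OF assms(1)] by blast
  have "inj_on ((`) f) (edges A)"
    using inj_on_image_Pow[OF assms(3)] sub by (rule inj_on_subset)
  then have "card ((`) f ` edges A) = card (edges B)" using assms(6) by (simp add: card_image)
  then have eq: "(`) f ` edges A = edges B"
    using card_subset_eq[OF graph_finite_edges[OF assms(2)]] assms(5) by blast
  have "{u, v} \<in> edges A \<longleftrightarrow> {f u, f v} \<in> edges B" if "u \<in> verts A" "v \<in> verts A" for u v
  proof
    assume "{u, v} \<in> edges A" then show "{f u, f v} \<in> edges B" using assms(5) by fastforce
  next
    assume "{f u, f v} \<in> edges B"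
    then have "f ` {u, v} \<in> (`) f ` edges A" unfolding eq by simp
    then obtain e where e: "e \<in> edges A" "f ` e = f ` {u, v}" by (metis imageE)
    moreover have "e \<subseteq> verts A" "{u, v} \<subseteq> verts A" using e(1) sub that by auto
    ultimately have "e = {u, v}" using inj_on_image_eq_iff[OF assms(3)] by metis
    then show "{u, v} \<in> edges A" using e by simp
  qed
  then show ?thesis using assms(3,4) unfolding graph_iso_def bij_betw_def by blast
qed

definition six_cycle :: "'a graph \<Rightarrow> 'a set \<Rightarrow> 'a \<Rightarrow> 'a \<Rightarrow> 'a \<Rightarrow> 'a \<Rightarrow> 'a \<Rightarrow> 'a \<Rightarrow> bool" where
  "six_cycle G U a b c d e f \<longleftrightarrow> distinct [a, b, c, d, e, f] \<and> U = {a, b, c, d, e, f} \<and>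
     {{a, b}, {b, c}, {c, d}, {d, e}, {e, f}, {f, a}} \<subseteq> edges G"

text \<open>The edge count rules out chords, so \<open>U\<close> induces a 6-cycle.\<close>

definition hexagon :: "'a graph \<Rightarrow> 'a set \<Rightarrow> bool" where
  "hexagon G U \<longleftrightarrow>
     (\<exists>a b c d e f. six_cycle G U a b c d e f) \<and> card {e \<in> edges G. e \<subseteq> U} = 6"

lemma six_cycle_rotate: "six_cycle G U a b c d e f \<Longrightarrow> six_cycle G U b c d e f a"
  unfolding six_cycle_def by auto

text \<open>Rotating the cycle brings any chosen vertex to the front, which spares a case
  distinction over six positions later.\<close>

lemma hexagon_at:
  assumes "hexagon G U" "z \<in> U"
  obtains b c d e f where "distinct [z, b, c, d, e, f]" "U = {z, b, c, d, e, f}"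
     "{{z, b}, {b, c}, {c, d}, {d, e}, {e, f}, {f, z}} \<subseteq> edges G"
proof -
  obtain a b c d e f where P: "six_cycle G U a b c d e f"
    using assms(1) unfolding hexagon_def by (elim exE conjE)
  have z: "z = a \<or> z = b \<or> z = c \<or> z = d \<or> z = e \<or> z = f"
    using assms(2) P unfolding six_cycle_def by simp
  note P2 = six_cycle_rotate[OF P]
  note P3 = six_cycle_rotate[OF P2]
  note P4 = six_cycle_rotate[OF P3]
  note P5 = six_cycle_rotate[OF P4]
  note P6 = six_cycle_rotate[OF P5]
  have "\<exists>b c d e f. six_cycle G U z b c d e f"
    using z P P2 P3 P4 P5 P6 by (elim disjE) (simp only:, intro exI, assumption)+
  then obtain b c d e f where "six_cycle G U z b c d e f" by (elim exE)
  then show ?thesis unfolding six_cycle_def by (elim conjE) (rule that)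
qed

lemma domination_number_one_centre:
  assumes "graph F" "domination_number F = 1"
  obtains c where "c \<in> verts F" "\<And>u. u \<in> verts F \<Longrightarrow> u \<noteq> c \<Longrightarrow> {c, u} \<in> edges F"
proof -
  let ?P = "\<lambda>n. \<exists>D. dominating F D \<and> card D = n"
  \<comment> \<open>Some dominating set exists, so the \<open>LEAST\<close> is attained.\<close>
  have "dominating F (verts F)" unfolding dominating_def closed_nbhd_def by auto
  then have "?P (card (verts F))" by blast
  then have "?P (LEAST n. ?P n)" by (rule LeastI)
  then obtain D where "dominating F D" "card D = 1"
    using assms(2) unfolding domination_number_def by auto
  then obtain c where "dominating F {c}" by (auto simp: card_1_singleton_iff)
  then show ?thesis
    using that[of c] unfolding dominating_def closed_nbhd_def adj_def
    by (fastforce simp: insert_commute)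
qed

lemma iota_le: "isolating G F D \<Longrightarrow> iota G F \<le> card D"
  unfolding iota_def by (rule Least_le) blast

section \<open>Induced vertex sets, copies and edge counts in a fixed graph\<close>

locale isolation =
  fixes G :: "'a graph" and F :: "'b graph" and c :: 'b
  assumes graph_G: "graph G" and graph_F: "graph F" and c_in: "c \<in> verts F"
    and c_dom: "\<And>u. u \<in> verts F \<Longrightarrow> u \<noteq> c \<Longrightarrow> {c, u} \<in> edges F"
begin

abbreviation "V \<equiv> verts G"
abbreviation "E \<equiv> edges G"
abbreviation "k \<equiv> card (edges F)"
abbreviation "N \<equiv> closed_nbhd G"

definition inside where "inside U = {e \<in> E. e \<subseteq> U}"
text \<open>The budget of \<open>W\<close> in \<open>U\<close>: exactly the edges that vanish when
  \<open>W\<close> is removed from \<open>U\<close>.\<close>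

definition meeting where "meeting U W = {e \<in> E. e \<subseteq> U \<and> e \<inter> W \<noteq> {}}"
definition cross where "cross U W = {e \<in> E. e \<subseteq> U \<and> e \<inter> W \<noteq> {} \<and> \<not> e \<subseteq> W}"
definition sep where "sep A B \<longleftrightarrow> (\<forall>x\<in>A. \<forall>y\<in>B. {x, y} \<notin> E)"
text \<open>Connectedness by cuts instead of paths, the form in which every later argument uses
  it.\<close>

definition conn where
  "conn U \<longleftrightarrow> U \<noteq> {} \<and> (\<forall>A. A \<subseteq> U \<and> A \<noteq> {} \<and> sep A (U - A) \<longrightarrow> A = U)"
text \<open>Only edges have to be preserved, because a contained copy is a subgraph and need not be
  induced.\<close>

definition copy where
  "copy f W \<longleftrightarrow> inj_on f (verts F) \<and> f ` verts F \<subseteq> W \<and> (\<forall>e\<in>edges F. f ` e \<in> E)"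
definition free where "free W \<longleftrightarrow> \<not> (\<exists>f. copy f W)"
text \<open>For a connected \<open>U\<close> the first alternative says that \<open>U\<close>
  induces a copy of \<open>F\<close> and nothing more, see \<open>copy_tight_image\<close>.\<close>

definition bad where
  "bad U \<longleftrightarrow> (\<exists>f. copy f U) \<and> card (inside U) = k \<or> k = 2 \<and> hexagon G U"
\<comment> \<open>The vertices of \<open>X\<close> are deleted for free, as part of the closed neighbourhood
  of a vertex outside \<open>W\<close>.\<close>
definition isol where "isol X W D \<longleftrightarrow> D \<subseteq> W \<and> free (W - X - N D)"
definition good where
  "good U \<longleftrightarrow> (\<exists>D. isol {} U D \<and> (k + 2) * card D \<le> card (inside U) + 1)"

lemma finite_V [simp]: "finite V" using graph_G unfolding graph_def by blast
lemma finite_E [simp]: "finite E" using graph_finite_edges[OF graph_G] .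
lemma finite_EF [simp]: "finite (edges F)" using graph_finite_edges[OF graph_F] .
lemma finite_VF [simp]: "finite (verts F)" using graph_F unfolding graph_def by blast
lemma finite_sub [simp]: "U \<subseteq> V \<Longrightarrow> finite U" using finite_subset[OF _ finite_V] .
lemma finite_inside [simp]: "finite (inside U)" unfolding inside_def by simp
lemma finite_meeting [simp]: "finite (meeting U W)" unfolding meeting_def by simp
lemma finite_cross [simp]: "finite (cross U W)" unfolding cross_def by simp

lemma edge_ne: "{x, y} \<in> E \<Longrightarrow> x \<noteq> y"
  by (metis graph_G graph_edgeE doubleton_eq_iff)

lemma edge_sym: "{x, y} \<in> E \<Longrightarrow> {y, x} \<in> E"
  by (simp add: insert_commute)

lemma edge_V: "{x, y} \<in> E \<Longrightarrow> x \<in> V \<and> y \<in> V"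
  using graph_edge_subset[OF graph_G] by blast

lemma in_N: "x \<in> N D \<longleftrightarrow> x \<in> D \<or> (\<exists>v\<in>D. {x, v} \<in> E)"
  unfolding closed_nbhd_def adj_def using edge_V by blast

lemma in_N1: "x \<in> N {v} \<longleftrightarrow> x = v \<or> {x, v} \<in> E"
  by (simp add: in_N)

lemma N_sym: "x \<in> N {v} \<longleftrightarrow> v \<in> N {x}"
  by (auto simp: in_N1 insert_commute)

lemma sep_sym: "sep A B \<longleftrightarrow> sep B A"
  unfolding sep_def using edge_sym by blast

lemma sep_mono: "sep A B \<Longrightarrow> A' \<subseteq> A \<Longrightarrow> B' \<subseteq> B \<Longrightarrow> sep A' B'"
  unfolding sep_def by blast

lemma sep_Un: "sep A (B \<union> C) \<longleftrightarrow> sep A B \<and> sep A C"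
  unfolding sep_def by blast

lemma copy_mono: "copy f W \<Longrightarrow> W \<subseteq> W' \<Longrightarrow> copy f W'"
  unfolding copy_def by blast

lemma free_mono: "free W' \<Longrightarrow> W \<subseteq> W' \<Longrightarrow> free W"
  unfolding free_def using copy_mono by blast

lemma copy_sub: "copy f W \<Longrightarrow> f c \<in> W"
  unfolding copy_def using c_in by blast

text \<open>Since \<open>c\<close> is adjacent to every other vertex of \<open>F\<close>, a copy
  never leaves the closed neighbourhood of its centre. All localisation of copies rests on
  this.\<close>

lemma copy_star: assumes "copy f W" shows "f ` verts F \<subseteq> W \<inter> N {f c}"
proof -
  have "f u \<in> N {f c}" if "u \<in> verts F" for u
  proof (cases "u = c")
    case False
    then have "{c, u} \<in> edges F" using c_dom that by blast
    then have "f ` {c, u} \<in> E" using assms unfolding copy_def by blast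
    then show ?thesis by (simp add: in_N1 insert_commute)
  qed (simp add: in_N1)
  then show ?thesis using assms unfolding copy_def by blast
qed

lemma copy_nbhd: "copy f W \<Longrightarrow> copy f (W \<inter> N {f c})"
  using copy_star unfolding copy_def by blast

lemma copy_edge_image:
  assumes "copy f W" shows "(`) f ` edges F \<subseteq> inside W" "card ((`) f ` edges F) = k"
proof -
  have sub: "edges F \<subseteq> Pow (verts F)" using graph_edge_subset[OF graph_F] by blast
  show "(`) f ` edges F \<subseteq> inside W" using assms sub unfolding copy_def inside_def by blast
  have "inj_on f (verts F)" using assms unfolding copy_def by blast
  then have "inj_on ((`) f) (edges F)" using inj_on_image_Pow sub inj_on_subset by blast
  then show "card ((`) f ` edges F) = k" by (simp add: card_image)
qed

lemma copy_card_le: "copy f W \<Longrightarrow> k \<le> card (inside W)"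
  using copy_edge_image card_mono[OF finite_inside] by metis

lemma copy_card_verts_le: "copy f W \<Longrightarrow> finite W \<Longrightarrow> card (verts F) \<le> card W"
  unfolding copy_def using card_mono card_image by metis

lemma conn_edge:
  assumes "conn U" "W \<subseteq> U" "W \<noteq> {}" "W \<noteq> U"
  obtains x y where "x \<in> W" "y \<in> U - W" "{x, y} \<in> E"
  using assms unfolding conn_def sep_def by blast

text \<open>With only \<open>k\<close> edges in \<open>W\<close>, each of them is the image of an
  edge of \<open>F\<close>. An edge leaving the image of the vertices would be one too many.\<close>

lemma copy_tight_image:
  assumes "copy f W" "conn W" "card (inside W) = k"
  shows "f ` verts F = W"
proof (rule ccontr)
  assume ne: "f ` verts F \<noteq> W"
  have "f ` verts F \<subseteq> W" "f ` verts F \<noteq> {}" using assms(1) c_in unfolding copy_def by auto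
  then obtain x y where xy: "x \<in> f ` verts F" "y \<in> W - f ` verts F" "{x, y} \<in> E"
    using conn_edge[OF assms(2) _ _ ne] by blast
  have "(`) f ` edges F = inside W"
    using copy_edge_image[OF assms(1)] assms(3) card_subset_eq[OF finite_inside] by metis
  moreover have "{x, y} \<in> inside W" using xy \<open>f ` verts F \<subseteq> W\<close> unfolding inside_def by blast
  ultimately obtain e where "e \<in> edges F" "f ` e = {x, y}" by (metis imageE)
  then have "y \<in> f ` verts F" using graph_edge_subset[OF graph_F] by blast
  then show False using xy by blast
qed

lemma inside_psubset:
  assumes "e \<in> inside W" "\<not> e \<subseteq> A" "A \<subseteq> W" shows "card (inside A) < card (inside W)"
proof (rule psubset_card_mono)
  show "inside A \<subset> inside W" using assms unfolding inside_def by blast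
qed simp

text \<open>Take a smallest set that contains \<open>x\<close> and has no edge to the rest of
  \<open>W\<close>. If it had a cut without edges, the side containing \<open>x\<close> would be
  smaller.\<close>

lemma component_exists:
  assumes "W \<subseteq> V" "x \<in> W"
  obtains K where "x \<in> K" "K \<subseteq> W" "conn K" "sep K (W - K)"
proof -
  let ?P = "\<lambda>K. x \<in> K \<and> K \<subseteq> W \<and> sep K (W - K)"
  have "?P W" using assms unfolding sep_def by blast
  then obtain K where K: "?P K" and min: "\<And>K'. ?P K' \<Longrightarrow> card K \<le> card K'"
    using ex_has_least_nat[of ?P W card] by blast
  have fin: "finite K" using K assms finite_sub by blast
  have "A = K" if A: "A \<subseteq> K" "A \<noteq> {}" "sep A (K - A)" for A
  proof (rule ccontr)
    assume "A \<noteq> K"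
    then have small: "card A < card K" "card (K - A) < card K"
      using A fin by (auto intro!: psubset_card_mono)
    have KA: "sep K (W - K)" using K by blast
    have "sep A (W - A)"
      using A(3) KA A(1) unfolding sep_def by blast
    moreover have "sep (K - A) (W - (K - A))"
      using A(3) KA A(1) sep_sym[of A "K - A"] unfolding sep_def by blast
    ultimately show False using min[of A] min[of "K - A"] small K A(1) by fastforce
  qed
  then have "conn K" using K unfolding conn_def by blast
  then show ?thesis using that K by blast
qed

lemma meeting_Un:
  assumes "sep A B"
    and "A \<inter> B = {}"
  shows "card (meeting U (A \<union> B)) = card (meeting U A) + card (meeting U B)"
proof -
  have "meeting U (A \<union> B) = meeting U A \<union> meeting U B" unfolding meeting_def by blast
  moreover have "meeting U A \<inter> meeting U B = {}"
  proof (rule ccontr)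
    assume "meeting U A \<inter> meeting U B \<noteq> {}"
    then obtain e x y where e: "e \<in> E" "x \<in> e" "x \<in> A" "y \<in> e" "y \<in> B"
      unfolding meeting_def by blast
    then have "x \<noteq> y" using assms by blast
    obtain u v where "e = {u, v}" using graph_edgeE[OF graph_G e(1)] by metis
    then have "e = {x, y}" using e \<open>x \<noteq> y\<close> by auto
    then show False using assms e unfolding sep_def by blast
  qed
  ultimately show ?thesis by (simp add: card_Un_disjoint)
qed

lemma inside_split:
  assumes "S \<subseteq> U" shows "card (inside U) = card (inside S) + card (meeting U (U - S))"
proof -
  have "inside U = inside S \<union> meeting U (U - S)" "inside S \<inter> meeting U (U - S) = {}"
    using assms unfolding meeting_def inside_def by blast+
  then show ?thesis by (simp add: card_Un_disjoint)
qed

lemma meeting_cross: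
  assumes "W \<subseteq> U" shows "card (meeting U W) = card (inside W) + card (cross U W)"
proof -
  have "e \<inter> W \<noteq> {}" if "e \<in> E" "e \<subseteq> W" for e
    using graph_edgeE[OF graph_G that(1)] that(2) by blast
  then have "meeting U W = inside W \<union> cross U W" "inside W \<inter> cross U W = {}"
    using assms unfolding meeting_def inside_def cross_def by blast+
  then show ?thesis by (simp add: card_Un_disjoint)
qed

lemma cross_edge:
  assumes "e \<in> cross U W" obtains y z where "e = {y, z}" "y \<in> U - W" "z \<in> W" 
proof -
  have e: "e \<in> E" "e \<subseteq> U" "e \<inter> W \<noteq> {}" "\<not> e \<subseteq> W" using assms unfolding cross_def by auto
  obtain u v where "e = {u, v}" using graph_edgeE[OF graph_G e(1)] by metis
  then show ?thesis using that[of u v] that[of v u] e by (auto simp: insert_commute)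
qed

lemma crossI: "{y, z} \<in> E \<Longrightarrow> y \<in> U - W \<Longrightarrow> z \<in> W \<Longrightarrow> W \<subseteq> U \<Longrightarrow> {y, z} \<in> cross U W"
  unfolding cross_def by blast

lemma cross_nonempty:
  assumes "conn U" "W \<subset> U" "W \<noteq> {}" shows "cross U W \<noteq> {}"
  using conn_edge[OF assms(1), of W] assms(2,3) crossI[of _ _ U W]
  by (metis empty_iff insert_commute psubsetE)

text \<open>The centre of the copy lies on one side, and by \<open>copy_nbhd\<close> the whole copy
  stays on that side.\<close>

lemma copy_sep:
  assumes "copy f W" "W \<subseteq> A \<union> B" "sep A B"
  shows "copy f (W \<inter> A) \<or> copy f (W \<inter> B)"
proof -
  have *: "copy f (W \<inter> X)" if "sep X Y" "W \<subseteq> X \<union> Y" "f c \<in> X" for X Y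
  proof -
    have "W \<inter> N {f c} \<subseteq> X"
      using that edge_sym unfolding sep_def by (auto simp: in_N1) (metis UnE subsetD)
    then show ?thesis using copy_mono[OF copy_nbhd[OF assms(1)], of "W \<inter> X"] by blast
  qed
  show ?thesis
    using *[OF assms(3,2)] *[of B A] assms sep_sym copy_sub[OF assms(1)] by blast
qed

lemma isol_Un:
  assumes "isol X A D" "isol X B D'" "sep A B"
  shows "isol X (A \<union> B) (D \<union> D')"
proof -
  have "\<not> copy f (A \<union> B - X - N (D \<union> D'))" for f
  proof
    assume "copy f (A \<union> B - X - N (D \<union> D'))" (is "copy f ?W")
    then have "copy f (?W \<inter> A) \<or> copy f (?W \<inter> B)" using copy_sep[OF _ _ assms(3)] by blast
    moreover have "?W \<inter> A \<subseteq> A - X - N D" "?W \<inter> B \<subseteq> B - X - N D'" by (auto simp: in_N)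
    ultimately show False using assms(1,2) copy_mono unfolding isol_def free_def by metis
  qed
  then show ?thesis using assms(1,2) unfolding isol_def free_def by blast
qed

lemma isol_mono: "isol X W D \<Longrightarrow> X \<subseteq> Y \<Longrightarrow> isol Y W D"
  unfolding isol_def using free_mono by (metis Diff_mono order_refl)

text \<open>Components are split off one at a time; both the isolating sets and the edge budgets add
  up over separated parts.\<close>

lemma isol_parts:
  assumes "W \<subseteq> V"
    and "\<And>K. K \<subseteq> W \<Longrightarrow> conn K \<Longrightarrow> sep K (W - K) \<Longrightarrow>
      \<exists>D. isol X K D \<and> (k + 2) * card D \<le> card (meeting U K)"
  shows "\<exists>D. isol X W D \<and> (k + 2) * card D \<le> card (meeting U W)"
  using assms
proof (induction "card W" arbitrary: W rule: less_induct)
  case less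
  show ?case
  proof (cases "W = {}")
    case True
    have "free {}" unfolding free_def copy_def using c_in by blast
    then show ?thesis unfolding isol_def True by (intro exI[of _ "{}"]) auto
  next
    case False
    then obtain x where "x \<in> W" by blast
    then obtain K where K: "x \<in> K" "K \<subseteq> W" "conn K" "sep K (W - K)"
      using component_exists less.prems(1) by metis
    have sm: "card (W - K) < card W" using K less.prems(1) by (auto intro!: psubset_card_mono)
    have "\<exists>D. isol X K' D \<and> (k + 2) * card D \<le> card (meeting U K')"
      if K': "K' \<subseteq> W - K" "conn K'" "sep K' (W - K - K')" for K'
    proof (rule less.prems(2))
      \<comment> \<open>A component of \<open>W - K\<close> is a component of \<open>W\<close>,
        because \<open>K\<close> has no edges to the rest.\<close>
      have "sep K' K" using K(4) K'(1) sep_sym sep_mono by blast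
      moreover have "W - K' \<subseteq> (W - K - K') \<union> K" by blast
      ultimately show "sep K' (W - K')" using K'(3) sep_Un sep_mono by blast
    qed (use K' in auto)
    then obtain D' where D': "isol X (W - K) D'" "(k + 2) * card D' \<le> card (meeting U (W - K))"
      using less.hyps[OF sm] less.prems(1) by blast
    obtain D where D: "isol X K D" "(k + 2) * card D \<le> card (meeting U K)"
      using less.prems(2) K by blast
    have W: "K \<union> (W - K) = W" using K by blast
    have "card (meeting U W) = card (meeting U K) + card (meeting U (W - K))"
      using meeting_Un[OF K(4), of U] W by auto
    moreover have "(k + 2) * card (D \<union> D') \<le> (k + 2) * (card D + card D')"
      by (intro mult_left_mono card_Un_le) simp
    ultimately have "(k + 2) * card (D \<union> D') \<le> card (meeting U W)"
      using D(2) D'(2) by (simp add: distrib_left)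
    moreover have "isol X W (D \<union> D')" using isol_Un[OF D(1) D'(1) K(4)] W by simp
    ultimately show ?thesis by blast
  qed
qed

section \<open>Bad sets and their cost\<close>

lemma card_VF_if_k2: assumes "k = 2"
  obtains p q where "verts F = {c, p, q}" "p \<noteq> c" "q \<noteq> c" "p \<noteq> q" "edges F = {{c, p}, {c, q}}"
proof -
  \<comment> \<open>Each vertex other than \<open>c\<close> uses up its own edge at
    \<open>c\<close>, so there are at most two of them; with fewer than two, \<open>F\<close> could
    not have two edges.\<close>
  have inj: "inj_on (\<lambda>u. {c, u}) (verts F - {c})" by (auto simp: inj_on_def doubleton_eq_iff)
  have sub: "(\<lambda>u. {c, u}) ` (verts F - {c}) \<subseteq> edges F" using c_dom by auto
  then have le: "card (verts F - {c}) \<le> 2"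
    using card_mono[OF finite_EF sub] card_image[OF inj] assms by simp
  have "card (verts F - {c}) = 2"
  proof (rule ccontr)
    assume "card (verts F - {c}) \<noteq> 2"
    then have "card (verts F - {c}) \<le> Suc 0" using le by simp
    then have "\<forall>a\<in>verts F - {c}. \<forall>b\<in>verts F - {c}. a = b"
      by (simp add: card_le_Suc0_iff_eq)
    then obtain p where p: "verts F - {c} \<subseteq> {p}" by blast
    have "e = {c, p}" if "e \<in> edges F" for e
      using graph_edgeE[OF graph_F that] p by (metis Diff_iff doubleton_eq_iff singletonD subsetD)
    then have "edges F \<subseteq> {{c, p}}" by blast
    then have "k \<le> 1" using card_mono[of "{{c, p}}" "edges F"] by simp
    then show False using assms by simp
  qed
  then obtain p q where pq: "verts F - {c} = {p, q}" "p \<noteq> q" by (auto simp: card_2_iff)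
  have "{{c, p}, {c, q}} = edges F"
  proof (rule card_subset_eq)
    show "{{c, p}, {c, q}} \<subseteq> edges F" using sub pq by auto
    show "card {{c, p}, {c, q}} = k" using pq assms by (auto simp: doubleton_eq_iff)
  qed simp
  moreover have "p \<noteq> c" "q \<noteq> c" "verts F = {c, p, q}" using pq c_in by blast+
  ultimately show ?thesis using that[of p q] pq(2) by simp
qed

text \<open>A tight copy of \<open>F\<close> needs all vertices of \<open>K\<close>, so losing
  \<open>z\<close> suffices and \<open>D\<close> is empty. In a hexagon, \<open>D\<close> consists
  of the vertex opposite to \<open>z\<close>: only the two neighbours of \<open>z\<close> survive,
  too few for \<open>P3\<close>.\<close>

lemma bad_delete_vertex:
  assumes "bad K" "conn K" "K \<subseteq> V" "z \<in> K"
  obtains D where "D \<subseteq> K" "free (K - {z} - N D)" "(k + 2) * (card D + 1) \<le> card (inside K) + 2"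
proof (cases "(\<exists>f. copy f K) \<and> card (inside K) = k")
  case True
  have "\<not> copy f (K - {z})" for f
  proof
    assume f: "copy f (K - {z})"
    then have "f ` verts F = K" using copy_tight_image[OF copy_mono, of f _ K] True assms(2) by blast
    then show False using f assms(4) unfolding copy_def by blast
  qed
  then have "free (K - {z} - N {})" using free_mono unfolding free_def by (metis Diff_subset)
  then show ?thesis using that[of "{}"] True by simp
next
  case False
  then have hex: "k = 2" "hexagon G K" using assms(1) unfolding bad_def by auto
  obtain a b d e f where h: "distinct [z, a, b, d, e, f]" "K = {z, a, b, d, e, f}"
     "{{z, a}, {a, b}, {b, d}, {d, e}, {e, f}, {f, z}} \<subseteq> E"
    using hexagon_at[OF hex(2) assms(4)] by metis
  have "K - {z} - N {d} \<subseteq> {a, f}" using h by (auto simp: in_N1 insert_commute)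
  moreover have "free {a, f}"
  proof -
    have "card {a, f} < card (verts F)" using card_VF_if_k2[OF hex(1)] h(1)
      by (metis card_2_iff card_3_iff distinct_length_2_or_more lessI numeral_2_eq_2 numeral_3_eq_3)
    then show ?thesis unfolding free_def using copy_card_verts_le[of _ "{a, f}"] by fastforce
  qed
  moreover have "card (inside K) = 6" using hex(2) unfolding hexagon_def inside_def by blast
  ultimately show ?thesis using that[of "{d}"] free_mono h(2) hex(1) by simp
qed

text \<open>If nobody outside deletes \<open>z\<close>, then \<open>z\<close> itself joins the set
  found by \<open>bad_delete_vertex\<close>, at the price of one more vertex.\<close>

lemma bad_isol:
  assumes "bad K" "conn K" "K \<subseteq> V"
  obtains D where "isol {} K D" "(k + 2) * card D \<le> card (inside K) + 2"
proof -
  obtain z where z: "z \<in> K" using assms(2) unfolding conn_def by blast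
  then obtain D where D: "D \<subseteq> K" "free (K - {z} - N D)" "(k + 2) * (card D + 1) \<le> card (inside K) + 2"
    using bad_delete_vertex assms by metis
  have "K - {} - N (insert z D) \<subseteq> K - {z} - N D" by (auto simp: in_N)
  then have "isol {} K (insert z D)" using D z free_mono unfolding isol_def by blast
  moreover have "(k + 2) * card (insert z D) \<le> (k + 2) * (card D + 1)"
    using card_insert_le_m1[of "card D + 1" D z] by (intro mult_left_mono) auto
  ultimately show ?thesis using that D(3) by (meson order_trans)
qed

end

section \<open>A minimal counterexample and its pendant parts\<close>

locale counterexample = isolation +
  fixes U
  assumes U_V: "U \<subseteq> V" and conn_U: "conn U" and not_bad: "\<not> bad U" and not_good: "\<not> good U"
    and IH: "\<And>K. K \<subset> U \<Longrightarrow> conn K \<Longrightarrow> \<not> bad K \<Longrightarrow> good K"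
begin

text \<open>Otherwise \<open>insert y D\<close> would make \<open>U\<close> good. \<open>S\<close>
  may be as small as \<open>{y}\<close>; the rest of \<open>N {y}\<close> is then still deleted for
  free from \<open>U - S\<close>.\<close>

lemma vertex_bound:
  assumes "y \<in> U" "y \<in> S" "S \<subseteq> U \<inter> N {y}" "isol (N {y}) (U - S) D"
  shows "card (inside U) + 1 < (k + 2) * (card D + 1)"
proof (rule ccontr)
  assume a: "\<not> ?thesis"
  have "U - {} - N (insert y D) \<subseteq> (U - S) - N {y} - N D" using assms(3) by (auto simp: in_N in_N1)
  then have i: "isol {} U (insert y D)" using assms free_mono unfolding isol_def by blast
  have "(k + 2) * card (insert y D) \<le> (k + 2) * (card D + 1)"
    using card_insert_le_m1[of "card D + 1" D y] by (intro mult_left_mono) auto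
  also have "\<dots> \<le> card (inside U) + 1" using a by simp
  finally have "good U" using i unfolding good_def by blast
  then show False using not_good by simp
qed

text \<open>Connectedness of \<open>U\<close> gives a crossing edge. One crossing edge covers the
  \<open>+ 1\<close> of a good \<open>K\<close>, and two cover the \<open>+ 2\<close> from
  \<open>bad_isol\<close>, so only a bad \<open>K\<close> with a single crossing edge
  escapes.\<close>

lemma piece:
  assumes "K \<subset> U" "conn K"
  shows "(\<exists>D. isol {} K D \<and> (k + 2) * card D \<le> card (meeting U K)) \<or>
    bad K \<and> card (meeting U K) = card (inside K) + 1"
proof -
  have m: "card (meeting U K) = card (inside K) + card (cross U K)"
    using meeting_cross assms(1) by blast
  have "cross U K \<noteq> {}" using cross_nonempty[OF conn_U assms(1)] assms(2) unfolding conn_def by blast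
  then have c1: "card (cross U K) \<ge> 1" by (simp add: Suc_leI card_gt_0_iff)
  show ?thesis
  proof (cases "bad K")
    case False
    then obtain D where "isol {} K D" "(k + 2) * card D \<le> card (inside K) + 1"
      using IH assms unfolding good_def by blast
    then show ?thesis using m c1 by fastforce
  next
    case True
    have "K \<subseteq> V" using assms U_V by blast
    then obtain D where "isol {} K D" "(k + 2) * card D \<le> card (inside K) + 2"
      using bad_isol[OF True assms(2)] by metis
    then show ?thesis using m c1 True by (cases "card (cross U K) = 1") fastforce+
  qed
qed

lemma single_cross:
  assumes "K \<subset> U" "card (meeting U K) = card (inside K) + 1"
  obtains y z where "y \<in> U - K" "z \<in> K" "{y, z} \<in> E" "cross U K = {{y, z}}"
    "sep K (U - {y} - K)" "sep (K - {z}) (U - K)"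
proof -
  have "card (cross U K) = 1" using meeting_cross assms by fastforce
  then obtain e where e: "cross U K = {e}" by (auto simp: card_1_singleton_iff)
  then have "e \<in> cross U K" by simp
  then obtain y z where yz: "e = {y, z}" "y \<in> U - K" "z \<in> K" by (rule cross_edge)
  have *: "{a, b} = {y, z}" if "a \<in> K" "b \<in> U - K" "{a, b} \<in> E" for a b
    using crossI[of b a U K] that assms(1) e yz by (auto simp: insert_commute)
  have s: "sep K (U - {y} - K)" "sep (K - {z}) (U - K)"
    unfolding sep_def using * yz(2,3) by (fastforce simp: doubleton_eq_iff)+
  have "{y, z} \<in> E" using \<open>e \<in> cross U K\<close> yz(1) unfolding cross_def by simp
  then show ?thesis using that[OF yz(2,3)] s e yz(1) by simp
qed

text \<open>The vertex \<open>y\<close> already deletes \<open>z\<close>, which saves a vertex worth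
  \<open>k + 2\<close> edges compared with \<open>bad_isol\<close>. The deficit of one edge reduces
  this gain to \<open>k + 1\<close>.\<close>

lemma pendant_isol:
  assumes "K \<subset> U" "conn K" "bad K" "z \<in> K" "{y, z} \<in> E"
    and "card (meeting U K) = card (inside K) + 1"
  obtains D where "isol (N {y}) K D" "(k + 2) * card D + (k + 1) \<le> card (meeting U K)"
proof -
  have "K \<subseteq> V" using assms U_V by blast
  then obtain D where D: "D \<subseteq> K" "free (K - {z} - N D)"
    "(k + 2) * (card D + 1) \<le> card (inside K) + 2"
    using bad_delete_vertex[OF assms(3,2)] assms(4) by metis
  have "K - N {y} - N D \<subseteq> K - {z} - N D" using assms(5) by (auto simp: in_N1 insert_commute)
  then have "isol (N {y}) K D" using D free_mono unfolding isol_def by blast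
  then show ?thesis using that D(3) assms(6) by simp
qed

text \<open>The accounting scheme for spending \<open>y\<close>: the edges of \<open>U\<close> are
  split into those inside \<open>S\<close>, those meeting \<open>A\<close> and those meeting
  \<open>B\<close>, and the sets \<open>D\<close> and \<open>D'\<close> are combined by
  \<open>isol_Un\<close>.\<close>

lemma two_parts_bound:
  assumes "y \<in> U" "y \<in> S" "S \<subseteq> U \<inter> N {y}" "U - S = A \<union> B" "A \<inter> B = {}" "sep A B"
    and "isol (N {y}) A D" "isol (N {y}) B D'"
  shows "card (inside S) + card (meeting U A) + card (meeting U B) + 1
    < (k + 2) * card D + (k + 2) * card D' + (k + 2)"
proof -
  have "isol (N {y}) (U - S) (D \<union> D')" using isol_Un assms by simp
  then have "card (inside U) + 1 < (k + 2) * (card (D \<union> D') + 1)"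
    using vertex_bound[OF assms(1-3)] by blast
  also have "\<dots> \<le> (k + 2) * (card D + card D' + 1)"
    by (intro mult_left_mono add_right_mono card_Un_le) simp
  finally show ?thesis
    using inside_split[of S U] meeting_Un[OF assms(6,5), of U] assms(3,4)
    by (simp add: distrib_left)
qed

lemma not_pendant:
  assumes "K \<subset> U" "conn K" "bad K"
  shows "card (meeting U K) \<noteq> card (inside K) + 1"
proof
  assume m: "card (meeting U K) = card (inside K) + 1"
  obtain y z where yz: "y \<in> U - K" "z \<in> K" "{y, z} \<in> E" "sep K (U - {y} - K)"
    using single_cross[OF assms(1) m] by metis
  obtain D where D: "isol (N {y}) K D" "(k + 2) * card D + (k + 1) \<le> card (meeting U K)"
    using pendant_isol[OF assms yz(2,3) m] by metis
  \<comment> \<open>Besides \<open>K\<close>, other components may be bad and pendant, but then they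
    hang on \<open>y\<close> too and profit from it.\<close>
  have *: "\<exists>D. isol (N {y}) K' D \<and> (k + 2) * card D \<le> card (meeting U K')"
    if K': "K' \<subseteq> U - {y} - K" "conn K'" "sep K' (U - {y} - K - K')" for K'
  proof -
    have sub: "K' \<subset> U" using K' yz by blast
    consider "\<exists>D. isol {} K' D \<and> (k + 2) * card D \<le> card (meeting U K')"
      | "bad K'" "card (meeting U K') = card (inside K') + 1" using piece[OF sub K'(2)] by blast
    then show ?thesis
    proof cases
      case 1 then show ?thesis using isol_mono by blast
    next
      case 2
      obtain y' z' where y': "y' \<in> U - K'" "z' \<in> K'" "{y', z'} \<in> E"
        using single_cross[OF sub 2(2)] by metis
      \<comment> \<open>The only edge leaving \<open>K'\<close> can end neither in \<open>K\<close>
        nor in another component of \<open>U - {y} - K\<close>.\<close>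
      have "y' = y"
      proof (rule ccontr)
        assume "y' \<noteq> y"
        then have "y' \<in> K \<or> y' \<in> U - {y} - K - K'" using y' by blast
        then show False using y' K' yz(4) edge_sym unfolding sep_def by blast
      qed
      then show ?thesis using pendant_isol[OF sub K'(2) 2(1) y'(2)] y'(3) 2(2)
        by (metis add_leD1)
    qed
  qed
  obtain D' where D': "isol (N {y}) (U - {y} - K) D'"
      "(k + 2) * card D' \<le> card (meeting U (U - {y} - K))"
  proof -
    have "U - {y} - K \<subseteq> V" using U_V by blast
    then show ?thesis using isol_parts[of "U - {y} - K", OF _ *] that by metis
  qed
  have "card (inside {y}) + card (meeting U K) + card (meeting U (U - {y} - K)) + 1
    < (k + 2) * card D + (k + 2) * card D' + (k + 2)"
    by (rule two_parts_bound[OF _ _ _ _ _ yz(4) D(1) D'(1)]) (use yz assms(1) in \<open>auto simp: in_N1\<close>)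
  \<comment> \<open>The \<open>k + 1\<close> spare edges at \<open>K\<close> and the additive
    \<open>1\<close> of the bound together pay for \<open>y\<close>.\<close>
  then show False using D(2) D'(2) by linarith
qed

text \<open>By \<open>not_pendant\<close> the second alternative of \<open>piece\<close> never
  occurs, so every component pays for itself.\<close>

lemma region:
  assumes "W \<subset> U"
  obtains D where "isol {} W D" "(k + 2) * card D \<le> card (meeting U W)"
proof -
  have "\<exists>D. isol {} W D \<and> (k + 2) * card D \<le> card (meeting U W)"
  proof (rule isol_parts)
    fix K assume "K \<subseteq> W" "conn K"
    then show "\<exists>D. isol {} K D \<and> (k + 2) * card D \<le> card (meeting U K)"
      using piece[of K] not_pendant[of K] assms by (meson subset_psubset_trans)
  qed (use assms U_V in blast)
  then show ?thesis using that by blast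
qed

section \<open>Tightness around the centre of a copy\<close>

definition centre where "centre v \<longleftrightarrow> (\<exists>f. copy f U \<and> f c = v)"
definition nb where "nb v = U \<inter> N {v}"

lemma centre_in: "centre v \<Longrightarrow> v \<in> U"
  unfolding centre_def using copy_sub by blast

lemma nb_self: "v \<in> U \<Longrightarrow> v \<in> nb v" unfolding nb_def by (simp add: in_N1)

lemma centre_copy: "centre v \<Longrightarrow> \<exists>f. copy f (nb v) \<and> f c = v"
  unfolding centre_def nb_def using copy_nbhd by metis

text \<open>Spending \<open>v\<close> costs \<open>k + 2\<close>, of which the bound grants
  \<open>1\<close>; hence \<open>k + 1\<close> edges inside \<open>nb v\<close> would pay for it. A
  copy already provides \<open>k\<close>.\<close>

lemma centre_nb:
  assumes "centre v" shows "card (inside (nb v)) = k"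
proof -
  have v: "v \<in> U" using centre_in assms by blast
  have le: "k \<le> card (inside (nb v))" using centre_copy[OF assms] copy_card_le by blast
  have "U - nb v \<subset> U" using v nb_self by blast
  then obtain D where D: "isol {} (U - nb v) D" "(k + 2) * card D \<le> card (meeting U (U - nb v))"
    using region by metis
  have "card (inside U) + 1 < (k + 2) * (card D + 1)"
    by (rule vertex_bound[OF v, of "nb v"]) (use v nb_self isol_mono[OF D(1)] in \<open>auto simp: nb_def\<close>)
  moreover have "card (inside U) = card (inside (nb v)) + card (meeting U (U - nb v))"
    by (rule inside_split) (auto simp: nb_def)
  ultimately show ?thesis using D(2) le by (simp add: distrib_left)
qed

lemma conn_nb: assumes "v \<in> U" shows "conn (nb v)"
  unfolding conn_def
proof (intro conjI allI impI)
  show "nb v \<noteq> {}" using assms nb_self by blast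
  fix A assume A: "A \<subseteq> nb v \<and> A \<noteq> {} \<and> sep A (nb v - A)"
  have adj: "{x, v} \<in> E" if "x \<in> nb v" "x \<noteq> v" for x using that unfolding nb_def by (simp add: in_N1)
  have s: "{x, y} \<notin> E" if "x \<in> A" "y \<in> nb v" "y \<notin> A" for x y using A that unfolding sep_def by blast
  obtain x where x: "x \<in> A" using A by blast
  have vA: "v \<in> A"
  proof (rule ccontr)
    assume "v \<notin> A"
    then show False using s[OF x nb_self[OF assms]] adj[of x] A x by blast
  qed
  have "y \<in> A" if "y \<in> nb v" for y using s[OF vA that] edge_sym[OF adj[OF that]] vA by blast
  then show "A = nb v" using A by blast
qed

text \<open>By \<open>centre_nb\<close> the connected set \<open>nb (f c)\<close> has no edge to
  spare, so the copy fills it.\<close>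

lemma centre_image: "copy f U \<Longrightarrow> f ` verts F = nb (f c)"
  using copy_tight_image[of f "nb (f c)"] copy_nbhd[of f U] centre_nb conn_nb centre_in
  unfolding centre_def nb_def by blast

lemma centre_card_nb: "centre v \<Longrightarrow> card (nb v) = card (verts F)"
  using centre_image card_image unfolding centre_def copy_def by metis

lemma tight_part:
  assumes "centre v" "K \<subseteq> U - nb v" "sep K (U - nb v - K)" "isol {} K D"
  shows "card (meeting U K) \<le> (k + 2) * card D"
proof -
  have v: "v \<in> U" using centre_in assms by blast
  then have "U - nb v - K \<subset> U" using nb_self by blast
  then obtain D' where D': "isol {} (U - nb v - K) D'"
      "(k + 2) * card D' \<le> card (meeting U (U - nb v - K))"
    using region by metis
  have "card (inside (nb v)) + card (meeting U K) + card (meeting U (U - nb v - K)) + 1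
    < (k + 2) * card D + (k + 2) * card D' + (k + 2)"
    by (rule two_parts_bound[OF v _ _ _ _ assms(3) isol_mono[OF assms(4)] isol_mono[OF D'(1)]])
      (use assms(2) v nb_self in \<open>auto simp: nb_def\<close>)
  then show ?thesis using D'(2) centre_nb[OF assms(1)] by linarith
qed

lemma component_bad:
  assumes "centre v" "K \<subseteq> U - nb v" "sep K (U - nb v - K)" "conn K"
  shows "bad K" 
proof (rule ccontr)
  assume nbad: "\<not> bad K"
  have sub: "K \<subset> U" using assms(2) nb_self[OF centre_in[OF assms(1)]] centre_in[OF assms(1)] by blast
  obtain D where D: "isol {} K D" "(k + 2) * card D \<le> card (inside K) + 1"
    using IH[OF sub assms(4) nbad] unfolding good_def by blast
  have t: "card (meeting U K) \<le> (k + 2) * card D" using tight_part assms D by blast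
  have c1: "card (cross U K) \<ge> 1"
    using cross_nonempty[OF conn_U sub] assms(4) unfolding conn_def by (simp add: Suc_leI card_gt_0_iff)
  \<comment> \<open>The price of \<open>D\<close> is at most \<open>card (inside K) + 1\<close> by
    goodness and at least \<open>card (meeting U K)\<close> by tightness, so a single edge crosses
    and equality holds throughout.\<close>
  have m: "card (meeting U K) = card (inside K) + 1" and eq: "card (inside K) + 1 = (k + 2) * card D"
    using t D(2) c1 meeting_cross[of K U] sub by auto
  obtain y z where yz: "y \<in> U - K" "z \<in> K" "{y, z} \<in> E" "cross U K = {{y, z}}"
      "sep (K - {z}) (U - K)"
    using single_cross[OF sub m] by metis
  have subs: "K - {z} \<subset> U" "U - K \<subset> U" using sub yz by blast+
  obtain D1 where D1: "isol {} (K - {z}) D1" "(k + 2) * card D1 \<le> card (meeting U (K - {z}))"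
    using region[OF subs(1)] by metis
  obtain D2 where D2: "isol {} (U - K) D2" "(k + 2) * card D2 \<le> card (meeting U (U - K))"
    using region[OF subs(2)] by metis
  have "e \<notin> meeting U (K - {z})" if "e \<in> cross U K" for e
    using that yz unfolding meeting_def by auto
  moreover have "meeting U (K - {z}) \<subseteq> inside K \<union> cross U K"
    unfolding meeting_def inside_def cross_def by blast
  moreover have "inside K \<subseteq> meeting U (K - {z})"
  proof
    fix e assume "e \<in> inside K"
    then have e: "e \<in> E" "e \<subseteq> K" unfolding inside_def by auto
    obtain a b where "e = {a, b}" "a \<noteq> b" using graph_edgeE[OF graph_G e(1)] by metis
    then show "e \<in> meeting U (K - {z})" using e sub unfolding meeting_def by blast
  qed
  \<comment> \<open>Every edge inside \<open>K\<close> has an end other than \<open>z\<close>, while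
    the crossing edge meets \<open>K\<close> only in \<open>z\<close>.\<close>
  ultimately have mK: "meeting U (K - {z}) = inside K" by blast
  have "card (inside {z}) + card (meeting U (K - {z})) + card (meeting U (U - K)) + 1
    < (k + 2) * card D1 + (k + 2) * card D2 + (k + 2)"
    by (rule two_parts_bound[OF _ _ _ _ _ yz(5) isol_mono[OF D1(1)] isol_mono[OF D2(1)]])
      (use yz sub in \<open>auto simp: in_N1\<close>)
  \<comment> \<open>But \<open>card (inside K)\<close> is \<open>-1\<close> modulo \<open>k + 2\<close>, so \<open>D1\<close> leaves \<open>k + 1\<close> edges unused.\<close>
  then have "card (inside K) + 1 < (k + 2) * card D1 + (k + 2)" unfolding mK using D2(2) by simp
  then have "(k + 2) * card D < (k + 2) * (card D1 + 1)" using eq by (simp add: distrib_left)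
  then have "card D < card D1 + 1" by (metis nat_mult_less_cancel_disj)
  then have "(k + 2) * card D \<le> (k + 2) * card D1" by (intro mult_left_mono) auto
  then show False using eq D1(2) mK by simp
qed

text \<open>Tightness bounds the number of crossing edges by the \<open>+ 2\<close> of
  \<open>bad_isol\<close>, and \<open>not_pendant\<close> excludes a single one.\<close>

lemma component_cross:
  assumes "centre v" "K \<subseteq> U - nb v" "sep K (U - nb v - K)" "conn K"
  shows "card (cross U K) = 2"
proof -
  have bad: "bad K" using component_bad[OF assms] .
  have sub: "K \<subset> U" using assms(2) nb_self[OF centre_in[OF assms(1)]] centre_in[OF assms(1)] by blast
  obtain D where D: "isol {} K D" "(k + 2) * card D \<le> card (inside K) + 2"
    using bad_isol[OF bad assms(4)] sub U_V by (metis order_trans psubset_imp_subset)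
  have t: "card (meeting U K) \<le> (k + 2) * card D" using tight_part assms D by blast
  have "card (cross U K) \<ge> 1"
    using cross_nonempty[OF conn_U sub] assms(4) unfolding conn_def by (simp add: Suc_leI card_gt_0_iff)
  moreover have "card (meeting U K) = card (inside K) + card (cross U K)"
    using meeting_cross sub by blast
  ultimately show ?thesis using t D(2) not_pendant[OF sub assms(4) bad] by linarith
qed

text \<open>A vertex of a hexagon with an edge leaving it has three neighbours. For
  \<open>k = 2\<close> it is the centre of a copy, but three edges in its closed neighbourhood
  contradict \<open>centre_nb\<close>.\<close>

lemma component_copy:
  assumes "centre v" "K \<subseteq> U - nb v" "sep K (U - nb v - K)" "conn K"
  obtains f where "copy f K" "card (inside K) = k"
proof -
  have "\<not> (k = 2 \<and> hexagon G K)"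
  proof
    assume hex: "k = 2 \<and> hexagon G K"
    have "cross U K \<noteq> {}" using component_cross[OF assms] by fastforce
    then obtain e where e: "e \<in> cross U K" by blast
    then obtain y z where yz: "e = {y, z}" "y \<in> U - K" "z \<in> K" using cross_edge by metis
    then have yzE: "{y, z} \<in> E" using e unfolding cross_def by auto
    obtain a b where ab: "a \<in> K" "b \<in> K" "a \<noteq> b" "{z, a} \<in> E" "{z, b} \<in> E"
    proof -
      obtain a b d e f where "distinct [z, a, b, d, e, f]" "K = {z, a, b, d, e, f}"
        "{{z, a}, {a, b}, {b, d}, {d, e}, {e, f}, {f, z}} \<subseteq> E"
        using hexagon_at[of G K z] hex yz(3) by metis
      then show ?thesis using that[of a f] by (auto simp: insert_commute)
    qed
    obtain p q where pq: "verts F = {c, p, q}" "p \<noteq> c" "q \<noteq> c" "p \<noteq> q" "edges F = {{c, p}, {c, q}}"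
      using card_VF_if_k2 hex by metis
    have ne: "z \<noteq> a" "z \<noteq> b" using ab edge_ne by blast+
    have K: "K \<subseteq> U" using assms(2) by blast
    have "copy (\<lambda>u. if u = c then z else if u = p then a else b) U"
      unfolding copy_def using pq ne ab yz K edge_sym by auto
    then have "centre z" unfolding centre_def by auto
    then have "card (inside (nb z)) = 2" using centre_nb hex by simp
    moreover have "{{z, a}, {z, b}, {y, z}} \<subseteq> inside (nb z)"
      unfolding inside_def nb_def using ab yz yzE K by (auto simp: in_N1 insert_commute)
    moreover have "card {{z, a}, {z, b}, {y, z}} = 3"
      using ab yz ne by (auto simp: doubleton_eq_iff card_insert_if)
    ultimately show False using card_mono[OF finite_inside] by (metis eval_nat_numeral(3) not_less_eq_eq order_refl)
  qed
  then show ?thesis using component_bad[OF assms] that unfolding bad_def by blast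
qed

section \<open>Two copies joined by two edges\<close>

lemma two_copies:
  assumes "centre v"
  obtains w where "centre w" "U = nb v \<union> nb w" "nb v \<inter> nb w = {}" "card (cross U (nb w)) = 2"
proof -
  have v: "v \<in> U" using centre_in assms by blast
  have "nb v \<noteq> U"
  proof
    assume "nb v = U"
    then have "card (inside U) = k" using centre_nb[OF assms] by simp
    then show False using not_bad assms unfolding bad_def centre_def by blast
  qed
  then obtain x where "x \<in> U - nb v" unfolding nb_def by blast
  then obtain K where K: "K \<subseteq> U - nb v" "conn K" "sep K (U - nb v - K)"
    using component_exists[of "U - nb v"] U_V by (metis Diff_subset order_trans)
  obtain f where f: "copy f K" "card (inside K) = k" using component_copy[OF assms K(1,3,2)] by metis
  have fU: "copy f U" using f K copy_mono by blast
  define w where "w = f c"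
  have w: "centre w" using fU w_def unfolding centre_def by blast
  have nbw: "nb w = K" using centre_image[OF fU] copy_tight_image[OF f(1) K(2) f(2)] w_def by simp
  have "v \<in> U - K" using v K nb_self by blast
  then obtain Q where Q: "v \<in> Q" "Q \<subseteq> U - K" "conn Q" "sep Q (U - K - Q)"
    using component_exists[of "U - K"] U_V by (metis Diff_subset order_trans)
  have vQ: "nb v \<subseteq> Q"
  proof
    fix x assume x: "x \<in> nb v"
    then have "x \<in> U - K" "x = v \<or> {v, x} \<in> E" using K(1) unfolding nb_def
      by (auto simp: in_N1 insert_commute)
    then show "x \<in> Q" using Q unfolding sep_def by blast
  qed
  \<comment> \<open>A vertex outside \<open>K\<close> and \<open>Q\<close> is also outside
    \<open>nb v\<close>, hence joined neither to the component \<open>K\<close> of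
    \<open>U - nb v\<close> nor to the component \<open>Q\<close> of \<open>U - K\<close>. This
    contradicts connectedness of \<open>U\<close>.\<close>
  have "U - (K \<union> Q) = {}"
  proof (rule ccontr)
    assume ne: "U - (K \<union> Q) \<noteq> {}"
    have "U - (K \<union> Q) \<noteq> U" using Q by blast
    then obtain a b where ab: "a \<in> U - (K \<union> Q)" "b \<in> U - (U - (K \<union> Q))" "{a, b} \<in> E"
      using conn_edge[OF conn_U _ ne] by blast
    have "a \<in> U - nb v - K" "a \<in> U - K - Q" using ab vQ by blast+
    then show False using ab K(3) Q(4) unfolding sep_def by (auto simp: insert_commute)
  qed
  then have UKQ: "U = K \<union> Q" using K(1) Q(2) by blast
  \<comment> \<open>The component results now apply a second time, around the centre
    \<open>w\<close>.\<close>
  have "Q \<subseteq> U - nb w" "sep Q (U - nb w - Q)" using Q nbw by auto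
  then have eQ: "card (inside Q) = k" using component_copy[OF w _ _ Q(3)] by metis
  \<comment> \<open>A larger connected \<open>Q\<close> would contain an edge leaving
    \<open>nb v\<close>, and thus more than \<open>k\<close> edges.\<close>
  have "Q = nb v"
  proof (rule ccontr)
    assume ne: "Q \<noteq> nb v"
    obtain a b where ab: "a \<in> nb v" "b \<in> Q - nb v" "{a, b} \<in> E"
      using conn_edge[OF Q(3) vQ] ne nb_self[OF v] by blast
    then have "{a, b} \<in> inside Q" using vQ unfolding inside_def by blast
    then have "card (inside (nb v)) < card (inside Q)" using inside_psubset[OF _ _ vQ] ab by blast
    then show False using eQ centre_nb[OF assms] by simp
  qed
  then show ?thesis using that[OF w] UKQ nbw K(1) component_cross[OF assms K(1,3,2)] by blast
qed

text \<open>Deleting the closed neighbourhood of \<open>y1\<close> must leave a copy of \<open>F\<close>; its centre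
  cannot lie in \<open>nb v\<close>, and by tightness its closed neighbourhood must leave \<open>nb w\<close>,
  so it is the far end of the other cross edge.\<close>

lemma other_end_centre:
  assumes v: "centre v" and w: "centre w" and U: "U = nb v \<union> nb w" "nb v \<inter> nb w = {}"
    and y: "y1 \<in> nb v" "z1 \<in> nb w" "{y1, z1} \<in> E"
    and X: "\<And>a b. a \<in> nb v \<Longrightarrow> b \<in> nb w \<Longrightarrow> {a, b} \<in> E \<Longrightarrow> (a, b) = (y1, z1) \<or> (a, b) = (y2, z2)"
  shows "centre z2 \<and> y2 \<in> nb v \<and> z2 \<in> nb w \<and> {y2, z2} \<in> E \<and> nb z2 \<inter> nb y1 = {}"
proof -
  have yU: "y1 \<in> U" using y U by blast
  have "\<not> free (U - N {y1})"
  proof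
    assume "free (U - N {y1})"
    moreover have "U - {y1} - N {y1} \<subseteq> U - N {y1}" by blast
    ultimately have "isol {} U {y1}" unfolding isol_def using yU by simp
    \<comment> \<open>One vertex is affordable: \<open>nb v\<close> has \<open>k\<close> edges and
      \<open>{y1, z1}\<close> is one more.\<close>
    moreover have "(k + 2) * card {y1} \<le> card (inside U) + 1"
    proof -
      have "inside (nb v) \<subseteq> inside U" unfolding inside_def nb_def by blast
      moreover have "{y1, z1} \<in> inside U" "{y1, z1} \<notin> inside (nb v)"
        using y U unfolding inside_def by blast+
      ultimately have "card (inside (nb v)) < card (inside U)"
        by (intro psubset_card_mono) auto
      then show ?thesis using centre_nb[OF v] by simp
    qed
    ultimately show False using not_good unfolding good_def by blast
  qed
  then obtain g where g: "copy g (U - N {y1})" unfolding free_def by blast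
  define u where "u = g c"
  have gU: "copy g U" using g copy_mono by blast
  then have u: "centre u" unfolding centre_def u_def by blast
  have disj: "nb u \<inter> N {y1} = {}" using centre_image[OF gU] g unfolding u_def copy_def by blast
  have uU: "u \<in> U" using centre_in[OF u] .
  have "u \<notin> nb v"
  proof
    assume "u \<in> nb v"
    then have "v \<in> nb u" using N_sym centre_in[OF v] unfolding nb_def by blast
    moreover have "v \<in> N {y1}" using y(1) N_sym unfolding nb_def by blast
    ultimately show False using disj by blast
  qed
  then have uw: "u \<in> nb w" using U uU by blast
  have z1: "z1 \<in> N {y1}" using y(3) by (simp add: in_N1 insert_commute)
  have "\<not> nb u \<subseteq> nb w"
  proof
    assume sub: "nb u \<subseteq> nb w"
    have "w \<in> nb u" using uw N_sym centre_in[OF w] unfolding nb_def by blast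
    then have "z1 \<noteq> w" using z1 disj by blast
    then have "{z1, w} \<in> inside (nb w)"
      using y(2) nb_self[OF centre_in[OF w]] unfolding inside_def nb_def by (auto simp: in_N1)
    moreover have "\<not> {z1, w} \<subseteq> nb u" using disj z1 by blast
    ultimately have "card (inside (nb u)) < card (inside (nb w))" using inside_psubset sub by blast
    then show False using centre_nb u w by simp
  qed
  then obtain a where a: "a \<in> nb u" "a \<notin> nb w" by blast
  then have av: "a \<in> nb v" using U unfolding nb_def by blast
  have "a \<noteq> u" using a uw by blast
  then have au: "{a, u} \<in> E" using a(1) unfolding nb_def by (simp add: in_N1)
  have "u \<noteq> z1" using z1 disj nb_self[OF uU] by blast
  then have "a = y2" "u = z2" using X[OF av uw au] by auto
  then show ?thesis using u av uw au disj unfolding nb_def by blast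
qed

lemma no_counterexample: False
proof -
  have "\<not> free U"
  proof
    assume "free U"
    then have "isol {} U {}" unfolding isol_def using free_mono by (metis Diff_subset empty_subsetI)
    then show False using not_good unfolding good_def by fastforce
  qed
  then obtain v where v: "centre v" unfolding free_def centre_def by blast
  obtain w where w: "centre w" and U: "U = nb v \<union> nb w" "nb v \<inter> nb w = {}"
    and cr: "card (cross U (nb w)) = 2" using two_copies[OF v] by metis
  obtain e1 e2 where e12: "cross U (nb w) = {e1, e2}" "e1 \<noteq> e2" using cr by (auto simp: card_2_iff)
  obtain y1 z1 where y1: "e1 = {y1, z1}" "y1 \<in> U - nb w" "z1 \<in> nb w" using cross_edge e12(1) by (metis insertI1 insertI2)
  obtain y2 z2 where y2: "e2 = {y2, z2}" "y2 \<in> U - nb w" "z2 \<in> nb w" using cross_edge e12(1) by (metis insertI1 insertI2)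
  have y12: "y1 \<in> nb v" "y2 \<in> nb v" "{y1, z1} \<in> E" "{y2, z2} \<in> E"
    using y1 y2 U e12 unfolding cross_def by blast+
  have X: "(a, b) = (y1, z1) \<or> (a, b) = (y2, z2)"
    if "a \<in> nb v" "b \<in> nb w" "{a, b} \<in> E" for a b
  proof -
    have "a \<in> U - nb w" "nb w \<subseteq> U" using that(1) U by blast+
    then have "{a, b} \<in> cross U (nb w)" using crossI[OF that(3) _ that(2)] by blast
    then have "{a, b} = {y1, z1} \<or> {a, b} = {y2, z2}" unfolding e12 y1(1) y2(1) by simp
    moreover have "a \<noteq> z1" "a \<noteq> z2" using \<open>a \<in> U - nb w\<close> y1(3) y2(3) by blast+
    ultimately show ?thesis by (auto simp: doubleton_eq_iff)
  qed
  have zE: "{z1, y1} \<in> E" "{z2, y2} \<in> E" using y12 by (simp_all add: insert_commute)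
  have c2: "centre z2" "nb z2 \<inter> nb y1 = {}"
    using other_end_centre[OF v w U y12(1) y1(3) y12(3) X] by blast+
  \<comment> \<open>The same argument with the two crossing edges exchanged.\<close>
  have c1: "centre z1" "nb z1 \<inter> nb y2 = {}"
    using other_end_centre[OF v w U y12(2) y2(3) y12(4), of y1 z1] X by blast+
  have z12: "z1 \<noteq> z2" "{z1, z2} \<notin> E" "y1 \<noteq> y2"
  proof -
    have "z1 \<in> nb y1" "z2 \<in> nb z2" "y1 \<in> nb y1" "y2 \<in> nb z2"
      using y1 y2 y12 U zE unfolding nb_def by (auto simp: in_N1)
    then show "z1 \<noteq> z2" "{z1, z2} \<notin> E" "y1 \<noteq> y2"
      using c2(2) y1(3) unfolding nb_def by (auto simp: in_N1)
  qed
  have fin: "finite (nb x)" for x using U_V unfolding nb_def by (intro finite_sub) blast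
  \<comment> \<open>All closed neighbourhoods of centres have as many vertices as \<open>F\<close>,
    so the inclusion is an equality: \<open>z2\<close> is adjacent to every other vertex of
    \<open>nb w\<close> except \<open>z1\<close>.\<close>
  have nbz2: "nb z2 = insert y2 (nb w - {z1})"
  proof (rule card_subset_eq)
    show "finite (insert y2 (nb w - {z1}))" using fin by simp
    show "nb z2 \<subseteq> insert y2 (nb w - {z1})"
    proof
      fix x assume x: "x \<in> nb z2"
      then have "x \<in> U" "x = z2 \<or> {x, z2} \<in> E" unfolding nb_def by (auto simp: in_N1)
      then show "x \<in> insert y2 (nb w - {z1})" using z12 X[of x z2] y2(3) U by blast
    qed
    have "y2 \<notin> nb w" using y2 by blast
    then have "card (insert y2 (nb w - {z1})) = Suc (card (nb w - {z1}))"
      using fin by simp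
    also have "\<dots> = card (nb w)"
      by (rule card_Suc_Diff1) (use y1(3) fin in simp_all)
    finally show "card (nb z2) = card (insert y2 (nb w - {z1}))" using centre_card_nb c2 w by simp
  qed
  have nbz1: "nb z1 = insert y1 (nb w - {z2})"
  proof (rule card_subset_eq)
    show "finite (insert y1 (nb w - {z2}))" using fin by simp
    show "nb z1 \<subseteq> insert y1 (nb w - {z2})"
    proof
      fix x assume x: "x \<in> nb z1"
      then have "x \<in> U" "x = z1 \<or> {x, z1} \<in> E" unfolding nb_def by (auto simp: in_N1)
      then show "x \<in> insert y1 (nb w - {z2})" using z12 X[of x z1] y1(3) U
        by (auto simp: insert_commute)
    qed
    have "y1 \<notin> nb w" using y1 by blast
    then have "card (insert y1 (nb w - {z2})) = Suc (card (nb w - {z2}))"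
      using fin by simp
    also have "\<dots> = card (nb w)"
      by (rule card_Suc_Diff1) (use y2(3) fin in simp_all)
    finally show "card (nb z1) = card (insert y1 (nb w - {z2}))" using centre_card_nb c1 w by simp
  qed
  have wv: "w \<in> nb w" "v \<in> nb v" using nb_self centre_in v w by blast+
  have nw: "w \<noteq> z1" "w \<noteq> z2"
    using nbz1 nbz2 y1(2) y2(2) by blast+
  \<comment> \<open>A further vertex \<open>x\<close> would be adjacent to \<open>z1\<close>.
    Passing from \<open>nb w\<close> to \<open>nb z2\<close> then loses \<open>{x, z1}\<close> and
    \<open>{w, z1}\<close> and gains only \<open>{y2, z2}\<close>, although both sets contain
    \<open>k\<close> edges.\<close>
  have Q: "nb w = {w, z1, z2}"
  proof (rule ccontr)
    assume "nb w \<noteq> {w, z1, z2}"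
    then obtain x where x: "x \<in> nb w" "x \<noteq> w" "x \<noteq> z1" "x \<noteq> z2" using wv y1 y2 by blast
    then have xz: "{x, z1} \<in> E" using nbz1 unfolding nb_def by (auto simp: in_N1)
    have wz: "{w, z1} \<in> E" using nw nbz1 wv unfolding nb_def by (auto simp: in_N1)
    have "inside (nb z2) \<subseteq> insert {y2, z2} (inside (nb w) - {{x, z1}, {w, z1}})"
    proof
      fix e assume "e \<in> inside (nb z2)"
      then have e: "e \<in> E" "e \<subseteq> insert y2 (nb w - {z1})" unfolding inside_def nbz2 by auto
      show "e \<in> insert {y2, z2} (inside (nb w) - {{x, z1}, {w, z1}})"
      proof (cases "y2 \<in> e")
        case True
        obtain b where b: "e = {y2, b}" "b \<noteq> y2"
          using graph_edgeE[OF graph_G e(1)] True by (metis doubleton_eq_iff insertE singletonD)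
        then have "b \<in> nb w" using e by blast
        then have "b = z2" using X[OF y12(2), of b] e b z12 by auto
        then show ?thesis using b by simp
      next
        case False
        then have "e \<subseteq> nb w" "z1 \<notin> e" using e y1 y2 by auto
        then show ?thesis using e unfolding inside_def by auto
      qed
    qed
    then have "card (inside (nb z2)) \<le> card (insert {y2, z2} (inside (nb w) - {{x, z1}, {w, z1}}))"
      by (intro card_mono) auto
    also have "\<dots> \<le> Suc (card (inside (nb w) - {{x, z1}, {w, z1}}))" by (simp add: card_insert_if)
    also have "card (inside (nb w) - {{x, z1}, {w, z1}}) = card (inside (nb w)) - 2"
    proof -
      have "card {{x, z1}, {w, z1}} = 2" using x nw by (auto simp: doubleton_eq_iff)
      moreover have "{{x, z1}, {w, z1}} \<subseteq> inside (nb w)"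
        using xz wz x wv y1 unfolding inside_def by auto
      ultimately show ?thesis by (simp add: card_Diff_subset)
    qed
    finally have "k \<le> Suc (k - 2)" using centre_nb c2(1) w by simp
    \<comment> \<open>Subtraction truncates at zero, so the preceding inequality is contradictory
      only from \<open>k = 2\<close> on.\<close>
    moreover have "k \<ge> 2"
    proof -
      have "{{x, z1}, {w, z1}} \<subseteq> inside (nb w)"
        using xz wz x wv y1 unfolding inside_def by auto
      then have "card {{x, z1}, {w, z1}} \<le> k" using centre_nb[OF w] card_mono finite_inside by metis
      moreover have "card {{x, z1}, {w, z1}} = 2" using x nw by (auto simp: doubleton_eq_iff)
      ultimately show ?thesis by simp
    qed
    ultimately show False by simp
  qed
  have y_adj: "{w, z1} \<in> E" "{w, z2} \<in> E"
    using Q nw unfolding nb_def by (auto simp: in_N1 insert_commute)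
  have vy: "v \<noteq> y1" "v \<noteq> y2"
  proof -
    have "z1 \<notin> nb v" "z2 \<notin> nb v" using y1 y2 U by blast+
    then show "v \<noteq> y1" "v \<noteq> y2" using zE y1 y2 U unfolding nb_def by (auto simp: in_N1)
  qed
  have P: "nb v = {v, y1, y2}"
  proof (rule card_subset_eq[symmetric])
    show "finite (nb v)" using fin by simp
    show "{v, y1, y2} \<subseteq> nb v" using wv y12 by blast
    have "card (nb v) = card (nb w)" using centre_card_nb v w by simp
    then show "card {v, y1, y2} = card (nb v)" using Q nw z12 vy by simp
  qed
  have v_adj: "{v, y1} \<in> E" "{v, y2} \<in> E"
    using P vy unfolding nb_def by (auto simp: in_N1 insert_commute)
  have "inside (nb w) = {{w, z1}, {w, z2}}"
  proof (intro equalityI subsetI)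
    fix e assume "e \<in> inside (nb w)"
    then have e: "e \<in> E" "e \<subseteq> {w, z1, z2}" unfolding inside_def Q by auto
    obtain a b where "e = {a, b}" "a \<noteq> b" using graph_edgeE[OF graph_G e(1)] by metis
    then show "e \<in> {{w, z1}, {w, z2}}" using e z12 by (auto simp: insert_commute)
  qed (use y_adj Q in \<open>auto simp: inside_def\<close>)
  then have k2: "k = 2" using centre_nb[OF w] nw z12 by (auto simp: doubleton_eq_iff)
  have "card (inside U) = card (inside (nb v)) + card (meeting U (U - nb v))"
    by (rule inside_split) (auto simp: nb_def)
  also have "U - nb v = nb w" using U by blast
  also have "card (meeting U (nb w)) = card (inside (nb w)) + card (cross U (nb w))"
    by (rule meeting_cross) (auto simp: nb_def)
  finally have "card (inside U) = 6" using centre_nb v w cr k2 by simp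
  \<comment> \<open>The copies are the paths \<open>y1 v y2\<close> and \<open>z1 w z2\<close>, and
    the crossing edges close them to a cycle. The count \<open>2 + 2 + 2\<close> leaves no room for
    a chord.\<close>
  moreover have "six_cycle G U v y1 z1 w z2 y2"
    unfolding six_cycle_def
    using P Q U vy nw z12 y_adj v_adj y12 zE y1 y2 wv by (auto simp: insert_commute)
  ultimately have "hexagon G U" unfolding hexagon_def inside_def by blast
  then show False using not_bad k2 unfolding bad_def by blast
qed

end

section \<open>From vertex sets back to the graph\<close>

context isolation
begin

lemma good_if_not_bad:
  assumes "U \<subseteq> V" "conn U" "\<not> bad U"
  shows "good U"
  using assms
proof (induction "card U" arbitrary: U rule: less_induct)
  case less
  show ?case
  proof (rule ccontr)
    assume "\<not> good U"
    then interpret counterexample G F c U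
    proof unfold_locales
      fix K assume "K \<subset> U" "conn K" "\<not> bad K"
      then show "good K" using less.hyps[of K] less.prems(1)
        by (meson finite_sub order_trans psubset_card_mono psubset_imp_subset)
    qed (use less.prems in auto)
    show False by (rule no_counterexample)
  qed
qed

lemma conn_if_connected:
  assumes "connected G" shows "conn V"
  unfolding conn_def
proof (intro conjI allI impI)
  show "V \<noteq> {}" using assms unfolding connected_def by blast
  fix A assume A: "A \<subseteq> V \<and> A \<noteq> {} \<and> sep A (V - A)"
  then obtain a where a: "a \<in> A" by blast
  have "x \<in> A" if "(adj G)\<^sup>*\<^sup>* a x" for x
    using that
  proof induction
    case (step y z)
    then show ?case using A edge_V unfolding adj_def sep_def by blast
  qed (rule a)
  then show "A = V" using assms A a unfolding connected_def by blast
qed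

lemma isolating_if_isol:
  assumes "isol {} V D" shows "isolating G F D"
proof -
  have "\<not> contains_copy (delete_verts G (N D)) F"
  proof
    assume "contains_copy (delete_verts G (N D)) F"
    then obtain H f where H: "subgraph H (delete_verts G (N D))" "graph_iso f F H"
      unfolding contains_copy_def is_copy_def by blast
    have "copy f (V - N D)"
      unfolding copy_def
    proof (intro conjI ballI)
      show "inj_on f (verts F)" using H(2) unfolding graph_iso_def bij_betw_def by blast
      show "f ` verts F \<subseteq> V - N D"
        using H unfolding graph_iso_def bij_betw_def subgraph_def delete_verts_def
        by (auto simp: verts_def)
      fix e assume e: "e \<in> edges F"
      obtain u v where "e = {u, v}" "u \<in> verts F" "v \<in> verts F"
        using graph_edgeE[OF graph_F e] by metis
      then have "f ` e \<in> edges H" using e H(2) unfolding graph_iso_def by auto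
      then show "f ` e \<in> E" using H(1) unfolding subgraph_def delete_verts_def by (auto simp: edges_def)
    qed
    then show False using assms unfolding isol_def free_def by auto
  qed
  then show ?thesis using assms unfolding isolating_def isol_def by blast
qed

lemma inside_V: "inside V = E"
  unfolding inside_def using graph_edge_subset[OF graph_G] by blast

text \<open>Each alternative of \<open>bad\<close> yields an explicit edge-preserving bijection
  between graphs with equally many edges, hence an isomorphism that the hypotheses exclude.\<close>

lemma not_bad_V:
  assumes "connected G" "\<not> is_copy G F" "\<not> (is_copy F P3 \<and> is_copy G C6)"
  shows "\<not> bad V"
proof
  assume "bad V"
  then consider f where "copy f V" "card E = k" | "k = 2" "hexagon G V"
    unfolding bad_def inside_V by blast
  then show False
  proof cases
    case 1
    have "graph_iso f F G"
    proof (rule graph_iso_if_card_edges_eq[OF graph_F graph_G])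
      show "f ` verts F = V"
        using copy_tight_image[OF 1(1) conn_if_connected] assms(1) 1(2) inside_V by simp
    qed (use 1 in \<open>auto simp: copy_def\<close>)
    then show False using assms(2) unfolding is_copy_def by blast
  next
    case 2
    obtain p q where pq: "verts F = {c, p, q}" "p \<noteq> c" "q \<noteq> c" "p \<noteq> q" "edges F = {{c, p}, {c, q}}"
      using card_VF_if_k2[OF 2(1)] by metis
    have P3v: "verts P3 = {0, 1, 2}" and P3e: "edges P3 = {{0, 1}, {1, 2}}"
      unfolding P3_def verts_def edges_def by simp_all
    have "graph P3" by (rule graphI) (auto simp: P3v P3e)
    \<comment> \<open>The middle vertex of \<open>P3\<close> is \<open>1\<close>, so
      \<open>c\<close> goes there.\<close>
    define h where "h i = (if i = 0 then p else if i = 1 then c else q)" for i :: nat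
    have "graph_iso h P3 F"
    proof (rule graph_iso_if_card_edges_eq[OF \<open>graph P3\<close> graph_F])
      have h: "h 0 = p" "h 1 = c" "h 2 = q" unfolding h_def by simp_all
      show "inj_on h (verts P3)" unfolding P3v using pq h by (simp add: inj_on_def)
      show "h ` verts P3 = verts F" unfolding P3v pq(1) using h by auto
      show "card (edges P3) = k" unfolding P3e 2(1) by (simp add: doubleton_eq_iff)
      fix e assume "e \<in> edges P3"
      then have "e = {0, 1} \<or> e = {1, 2}" unfolding P3e by simp
      then show "h ` e \<in> edges F" unfolding pq(5) using h by (auto simp: doubleton_eq_iff)
    qed
    then have F: "is_copy F P3" unfolding is_copy_def by blast
    have "card E = 6" using 2(2) unfolding hexagon_def inside_def[symmetric] inside_V by blast
    moreover obtain a b d e f g where h: "six_cycle G V a b d e f g"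
      using 2(2) unfolding hexagon_def by (elim exE conjE)
    moreover note h[unfolded six_cycle_def]
    ultimately have h: "distinct [a, b, d, e, f, g]" "V = {a, b, d, e, f, g}"
      "{{a, b}, {b, d}, {d, e}, {e, f}, {f, g}, {g, a}} \<subseteq> E" "card E = 6"
      by (simp_all only:)
    let ?h = "\<lambda>i. [a, b, d, e, f, g] ! i"
    have six: "{0..<6::nat} = {0, 1, 2, 3, 4, 5}" by auto
    have C6v: "verts C6 = {0, 1, 2, 3, 4, 5}" unfolding C6_def verts_def six by simp
    have "{i. i < (6::nat)} = {0, 1, 2, 3, 4, 5}" by auto
    then have "{{i, (i + 1) mod 6} |i. i < (6::nat)} = (\<lambda>i. {i, (i + 1) mod 6}) ` {0, 1, 2, 3, 4, 5}"
      by blast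
    then have C6e: "edges C6 = {{0, 1}, {1, 2}, {2, 3}, {3, 4}, {4, 5}, {5, 0}}"
      unfolding C6_def edges_def by (simp add: numeral_2_eq_2[symmetric])
    have "graph C6" by (rule graphI) (auto simp: C6v C6e)
    then have "graph_iso ?h C6 G"
    proof (rule graph_iso_if_card_edges_eq[OF _ graph_G])
      show "card (edges C6) = card E"
        unfolding h(4) C6e by (simp add: doubleton_eq_iff)
    qed (use h in \<open>auto simp: C6v C6e inj_on_def\<close>)
    then show False using assms(3) F unfolding is_copy_def by blast
  qed
qed

lemma iota_upper:
  assumes "connected G" "\<not> is_copy G F" "\<not> (is_copy F P3 \<and> is_copy G C6)"
  shows "iota G F \<le> (card E + 1) div (k + 2)"
proof -
  have "good V" using good_if_not_bad[OF order_refl conn_if_connected not_bad_V] assms by blast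
  then obtain D where D: "isol {} V D" "(k + 2) * card D \<le> card E + 1"
    unfolding good_def inside_V by blast
  then have "iota G F \<le> card D" using iota_le isolating_if_isol by blast
  also have "\<dots> \<le> (card E + 1) div (k + 2)"
    using D(2) by (simp add: less_eq_div_iff_mult_less_eq mult.commute)
  finally show ?thesis .
qed

end

section \<open>The lower bound for special graphs\<close>

lemma isolating_exists:
  assumes "verts F \<noteq> {}" shows "isolating G F (verts G)"
proof -
  have "\<not> contains_copy (delete_verts G (closed_nbhd G (verts G))) F"
  proof
    assume "contains_copy (delete_verts G (closed_nbhd G (verts G))) F"
    then obtain H f where "verts H \<subseteq> verts G - closed_nbhd G (verts G)" "f ` verts F = verts H"
      unfolding contains_copy_def is_copy_def graph_iso_def bij_betw_def subgraph_def delete_verts_def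
      by (auto simp: verts_def)
    then show False using assms unfolding closed_nbhd_def by auto
  qed
  then show ?thesis unfolding isolating_def by blast
qed

text \<open>Otherwise no vertex of \<open>H\<close> is deleted and the copy \<open>H\<close>
  survives.\<close>

lemma isolating_meets_closed_nbhd:
  assumes "isolating G F D" "graph H" "is_copy H F" "verts H \<subseteq> verts G" "edges H \<subseteq> edges G"
  shows "D \<inter> closed_nbhd G (verts H) \<noteq> {}"
proof
  assume d: "D \<inter> closed_nbhd G (verts H) = {}"
  have DV: "D \<subseteq> verts G" using assms(1) unfolding isolating_def by blast
  have disj: "verts H \<inter> closed_nbhd G D = {}"
    using d DV assms(4) unfolding closed_nbhd_def adj_def by (auto simp: disjoint_iff) (metis insert_commute subsetD)
  have "subgraph H (delete_verts G (closed_nbhd G D))"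
    using assms(2,4,5) disj graph_edge_subset[OF assms(2)]
    unfolding subgraph_def delete_verts_def by (fastforce simp: verts_def edges_def)
  then show False using assms(1,3) unfolding isolating_def contains_copy_def by blast
qed

lemma iota_lower_special:
  fixes G :: "'a graph" and F :: "'b graph"
  assumes "special_graph m F G" "verts F \<noteq> {}"
  shows "(m + 1) div (card (edges F) + 2) \<le> iota G F"
proof -
  define q where "q = (m + 1) div (card (edges F) + 2)"
  show ?thesis
  proof (cases "q = 0")
    case True then show ?thesis unfolding q_def by simp
  next
    case False
    obtain v :: "nat \<Rightarrow> 'a" and FF :: "nat \<Rightarrow> 'a graph" and w ET and T' :: "'a graph" where
      inj: "inj_on v {1..q}" and
      FF: "\<forall>i\<in>{1..q}. graph (FF i) \<and> is_copy (FF i) F" and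
      dF: "\<forall>i\<in>{1..q}. \<forall>j\<in>{1..q}. i \<noteq> j \<longrightarrow> verts (FF i) \<inter> verts (FF j) = {}" and
      dv: "\<forall>i\<in>{1..q}. verts (FF i) \<inter> v ` {1..q} = {}" and
      w: "\<forall>i\<in>{1..q}. w i \<in> verts (FF i)" and
      T: "tree (v ` {1..q}, ET)" and T': "graph T'" and
      iT': "verts T' \<inter> (\<Union>i\<in>{1..q}. verts (insert (v i) (verts (FF i)),
        insert {v i, w i} (edges (FF i)))) = {v q}" and
      G: "G = (verts T' \<union> (\<Union>i\<in>{1..q}. verts (insert (v i) (verts (FF i)),
                 insert {v i, w i} (edges (FF i)))),
               ET \<union> edges T' \<union> (\<Union>i\<in>{1..q}. edges (insert (v i) (verts (FF i)),
                 insert {v i, w i} (edges (FF i)))))"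
      using assms(1) unfolding special_graph_def Let_def q_def[symmetric] if_not_P[OF False]
      by (elim exE conjE) (rule that)
    have iT: "verts T' \<inter> (\<Union>i\<in>{1..q}. insert (v i) (verts (FF i))) = {v q}"
      using iT' by (simp add: verts_def)
    have vG: "verts G = verts T' \<union> (\<Union>i\<in>{1..q}. insert (v i) (verts (FF i)))"
      and eG: "edges G = ET \<union> edges T' \<union> (\<Union>i\<in>{1..q}. insert {v i, w i} (edges (FF i)))"
      unfolding G by (simp_all add: verts_def edges_def)
    define B where "B i = insert (v i) (verts (FF i))" for i
    have gT: "graph (v ` {1..q}, ET)" using T unfolding tree_def by blast
    have qq: "q \<in> {1..q}" using False by simp
    \<comment> \<open>The only vertex outside \<open>FF i\<close> that can be adjacent to it is
      \<open>v i\<close>: edges of the tree and of \<open>T'\<close> avoid \<open>FF i\<close>, and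
      so do those of the other blocks.\<close>
    have nb: "closed_nbhd G (verts (FF i)) \<subseteq> B i" if i: "i \<in> {1..q}" for i
    proof
      fix x assume "x \<in> closed_nbhd G (verts (FF i))"
      then consider "x \<in> verts (FF i)" | y where "y \<in> verts (FF i)" "{x, y} \<in> edges G"
        unfolding closed_nbhd_def adj_def by blast
      then show "x \<in> B i"
      proof cases
        case 1 then show ?thesis unfolding B_def by simp
      next
        case 2
        have yv: "y \<notin> v ` {1..q}" using dv i 2(1) by blast
        have "{x, y} \<notin> ET"
          using graph_edge_subset[OF gT, of "{x, y}"] yv by (auto simp: verts_def edges_def)
        moreover have "{x, y} \<notin> edges T'"
        proof
          assume "{x, y} \<in> edges T'"
          then have "y \<in> verts T'" using graph_edge_subset[OF T'] by blast
          then have "y = v q" using iT i 2(1) by blast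
          then show False using yv qq by blast
        qed
        ultimately obtain j where j: "j \<in> {1..q}" "{x, y} \<in> insert {v j, w j} (edges (FF j))"
          using 2(2) unfolding eG by auto
        show ?thesis
        proof (cases "{x, y} = {v j, w j}")
          case True
          \<comment> \<open>As \<open>y\<close> lies in \<open>FF i\<close>, it is none of the
            \<open>v\<close>, which fixes the orientation of the pair.\<close>
          then have "y = w j" "x = v j" using yv j(1) by (auto simp: doubleton_eq_iff)
          then have "j = i" using dF i j(1) w 2(1) by blast
          then show ?thesis unfolding B_def using \<open>x = v j\<close> by simp
        next
          case False
          then have "{x, y} \<subseteq> verts (FF j)" using j FF graph_edge_subset by blast
          then have "j = i" "x \<in> verts (FF j)" using dF i j(1) 2(1) by blast+
          then show ?thesis unfolding B_def by simp
        qed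
      qed
    qed
    have dB: "B i \<inter> B j = {}" if "i \<in> {1..q}" "j \<in> {1..q}" "i \<noteq> j" for i j
    proof -
      have "v i \<noteq> v j" using inj that unfolding inj_on_def by blast
      moreover have "v i \<notin> verts (FF j)" "v j \<notin> verts (FF i)" using dv that by blast+
      ultimately show ?thesis using dF that unfolding B_def by blast
    qed
    have main: "q \<le> card D" if D: "isolating G F D" for D
    proof -
      have "D \<inter> B i \<noteq> {}" if i: "i \<in> {1..q}" for i
      proof -
        have "verts (FF i) \<subseteq> verts G" "edges (FF i) \<subseteq> edges G"
          using i unfolding vG eG by auto
        then show ?thesis using isolating_meets_closed_nbhd[OF D] FF nb[OF i] i by blast
      qed
      then have "\<exists>d. \<forall>i\<in>{1..q}. d i \<in> D \<inter> B i" by (intro bchoice) blast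
      then obtain d where d: "\<And>i. i \<in> {1..q} \<Longrightarrow> d i \<in> D \<inter> B i" by blast
      have "inj_on d {1..q}"
      proof (rule inj_onI, rule ccontr)
        fix i j assume ij: "i \<in> {1..q}" "j \<in> {1..q}" "d i = d j" "i \<noteq> j"
        have "d i \<in> B i \<inter> B j" using d[OF ij(1)] d[OF ij(2)] ij(3) by simp
        then show False using dB[OF ij(1,2,4)] by simp
      qed
      moreover have "d ` {1..q} \<subseteq> D" using d by blast
      \<comment> \<open>For an infinite \<open>D\<close> the value of \<open>card D\<close> would be
        \<open>0\<close>.\<close>
      moreover have "finite D"
      proof -
        have "finite (verts G)"
          using T' FF unfolding vG graph_def by simp
        then show ?thesis using D finite_subset unfolding isolating_def by blast
      qed
      ultimately have "card {1..q} \<le> card D" by (rule card_inj_on_le)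
      then show ?thesis by simp
    qed
    obtain D where "isolating G F D" "card D = iota G F"
      using LeastI[of "\<lambda>n. \<exists>D. isolating G F D \<and> card D = n" "card (verts G)"]
        isolating_exists[OF assms(2), of G] unfolding iota_def by blast
    then show ?thesis using main[of D] unfolding q_def by simp
  qed
qed

theorem theorem1p2:
  fixes G :: "'a graph" and F :: "'b graph" and k m :: nat
  assumes "graph F" and "card (edges F) = k" and "domination_number F = 1"
    and "graph G" and "connected G" and "card (edges G) = m"
    and "\<not> is_copy G F"
    and "\<not> (is_copy F P3 \<and> is_copy G C6)"
  shows "iota G F \<le> (m + 1) div (k + 2) \<and>
         (special_graph m F G \<longrightarrow> iota G F = (m + 1) div (k + 2))"
proof -
  obtain c where c: "c \<in> verts F" "\<And>u. u \<in> verts F \<Longrightarrow> u \<noteq> c \<Longrightarrow> {c, u} \<in> edges F"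
    using domination_number_one_centre[OF assms(1,3)] by metis
  interpret isolation G F c by unfold_locales (use assms c in auto)
  have "iota G F \<le> (m + 1) div (k + 2)" using iota_upper assms by simp
  moreover have "(m + 1) div (k + 2) \<le> iota G F" if "special_graph m F G"
    using iota_lower_special[OF that] c assms(2) by auto
  ultimately show ?thesis by fastforce
qed

end
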